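(* Let $\mathcal{S}$ be the linear span (over $\mathbb{R}$) of the set of all copulas on $[0,1]^2$. The closure of $\mathcal{S}$ in the supremum norm contains all quasi-copulas $Q\colon[0,1]^2\to[0,1]$.
   Context: A quasi-copula is a function $Q\colon[0,1]^2\to[0,1]$ such that: (i) $Q(x,0)=Q(0,y)=0$ for all $x,y\in[0,1]$; (ii) $Q(x,1)=x$ and $Q(1,y)=y$ for all $x,y\in[0,1]$; (iii) $Q$ is increasing (i.e. nondecreasing) in each of its arguments; (iv) $|Q(x_2,y_2)-Q(x_1,y_1)|\le|x_2-x_1|+|y_2-y_1|$ for all $(x_1,y_1),(x_2,y_2)\in[0,1]^2$. A copula is a function $C\colon[0,1]^2\to[0,1]$ satisfying (i), (ii) and $C(x_2,y_2)+C(x_1,y_1)-C(x_2,y_1)-C(x_1,y_2)\ge0$ whenever $0\le x_1\le x_2\le1$ and $0\le y_1\le y_2\le1$. The supremum norm is $\|f\|=\sup_{(x,y)\in[0,1]^2}|f(x,y)|$ on bounded real functions on $[0,1]^2$. *)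

theory Defs
  imports "HOL-Analysis.Analysis"
begin

text \<open>Functions on the unit square are represented by functions extensional on it, so that
  two of them are equal iff they agree on the square.\<close>

abbreviation unit_square :: "(real \<times> real) set" where
  "unit_square \<equiv> {0..1} \<times> {0..1}"

definition quasi_copula :: "(real \<times> real \<Rightarrow> real) \<Rightarrow> bool" where
  "quasi_copula Q \<longleftrightarrow>
     Q \<in> unit_square \<rightarrow>\<^sub>E {0..1} \<and>
     (\<forall>x\<in>{0..1}. Q (x, 0) = 0) \<and> (\<forall>y\<in>{0..1}. Q (0, y) = 0) \<and>
     (\<forall>x\<in>{0..1}. Q (x, 1) = x) \<and> (\<forall>y\<in>{0..1}. Q (1, y) = y) \<and>
     (\<forall>y\<in>{0..1}. mono_on {0..1} (\<lambda>x. Q (x, y))) \<and>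
     (\<forall>x\<in>{0..1}. mono_on {0..1} (\<lambda>y. Q (x, y))) \<and>
     (\<forall>x1\<in>{0..1}. \<forall>y1\<in>{0..1}. \<forall>x2\<in>{0..1}. \<forall>y2\<in>{0..1}.
        \<bar>Q (x2, y2) - Q (x1, y1)\<bar> \<le> \<bar>x2 - x1\<bar> + \<bar>y2 - y1\<bar>)"

definition copula :: "(real \<times> real \<Rightarrow> real) \<Rightarrow> bool" where
  "copula C \<longleftrightarrow>
     C \<in> unit_square \<rightarrow>\<^sub>E {0..1} \<and>
     (\<forall>x\<in>{0..1}. C (x, 0) = 0) \<and> (\<forall>y\<in>{0..1}. C (0, y) = 0) \<and>
     (\<forall>x\<in>{0..1}. C (x, 1) = x) \<and> (\<forall>y\<in>{0..1}. C (1, y) = y) \<and>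
     (\<forall>x1 x2 y1 y2. 0 \<le> x1 \<and> x1 \<le> x2 \<and> x2 \<le> 1 \<and> 0 \<le> y1 \<and> y1 \<le> y2 \<and> y2 \<le> 1 \<longrightarrow>
        C (x2, y2) + C (x1, y1) - C (x2, y1) - C (x1, y2) \<ge> 0)"

text \<open>Linear span in the real vector space of functions on \<open>S\<close> with pointwise operations.
  The restriction keeps pointwise linear combinations extensional, and the formula is that of
  \<open>span_explicit\<close>.\<close>

definition fun_span_on :: "'a set \<Rightarrow> ('a \<Rightarrow> real) set \<Rightarrow> ('a \<Rightarrow> real) set" where
  "fun_span_on S B =
     {restrict (\<lambda>p. \<Sum>f\<in>T. r f * f p) S | T r. finite T \<and> T \<subseteq> B}"

text \<open>The metric of \<^term>\<open>funspace S euclidean_metric\<close> on bounded functions is the one induced by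
  the supremum norm.\<close>

lemma mdist_funspace_sup_norm:
  fixes f g :: "'a \<Rightarrow> real"
  assumes "f \<in> extensional S" "g \<in> extensional S" "bounded (f ` S)" "bounded (g ` S)" "S \<noteq> {}"
  shows "mdist (funspace S euclidean_metric) f g = (SUP p\<in>S. \<bar>f p - g p\<bar>)"
proof -
  have "f \<in> Met_TC.fspace S" "g \<in> Met_TC.fspace S"
    using assms by (auto simp: Met_TC.fspace_def)
  then show ?thesis
    using assms(5) by (simp add: mdist_funspace Met_TC.fdist_def dist_real_def)
qed

lemma copula_in_funspace:
  assumes "copula C"
  shows "C \<in> mspace (funspace unit_square euclidean_metric)"
proof -
  have C: "C \<in> unit_square \<rightarrow>\<^sub>E {0..1}"
    using assms by (simp add: copula_def)
  then have "bounded (C ` unit_square)"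
    by (intro bounded_subset[OF bounded_closed_interval[of 0 1]]) (auto simp: PiE_def Pi_def)
  with C show ?thesis
    by (auto simp: Met_TC.fspace_def PiE_def)
qed

end

theory Submission
  imports Defs
begin

text \<open>
  A function \<open>F\<close> with the boundary values of a copula lies in the span of the copulas as soon as
  the volumes that it assigns to rectangles are bounded below by \<open>- c\<close> times their area, \<open>c \<ge> 0\<close>: if \<open>\<Pi>\<close>
  denotes the product copula \<open>x * y\<close>, which assigns to each rectangle its area, then
  \<open>C = (F + c \<Pi>) / (1 + c)\<close> has the same boundary values and nonnegative volumes, so it is a
  copula, and \<open>F = (1 + c) C - c \<Pi>\<close>.  This is \<open>in_copula_span_if_rect_volume_ge\<close>.

  It therefore suffices to approximate a quasi-copula uniformly by such functions, and the
  bivariate Bernstein polynomials are suitable.  On each edge of the square they are the univariate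
  Bernstein polynomials of the edge values, and these reproduce affine functions, so the boundary
  values are kept.  Their rectangle volumes are controlled by the area because they
  are finite sums of products \<open>b x * b' y\<close> of Lipschitz functions
  (\<open>rect_volume_bernstein_surface_ge\<close>).  They converge uniformly, with error at most \<open>2 / sqrt n\<close>,
  because a quasi-copula is 1-Lipschitz for the sum norm and the relative frequency of successes in
  \<open>n\<close> independent trials has mean absolute deviation at most \<open>1 / sqrt n\<close> (\<open>bernstein_surface_error\<close>).
\<close>

section \<open>Functions whose negative rectangle volumes are dominated by area\<close>

definition copula_boundary :: "(real \<times> real \<Rightarrow> real) \<Rightarrow> bool" where
  "copula_boundary F \<longleftrightarrow>
     (\<forall>x\<in>{0..1}. F (x, 0) = 0) \<and> (\<forall>y\<in>{0..1}. F (0, y) = 0) \<and>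
     (\<forall>x\<in>{0..1}. F (x, 1) = x) \<and> (\<forall>y\<in>{0..1}. F (1, y) = y)"

definition rect_volume :: "(real \<times> real \<Rightarrow> real) \<Rightarrow> real \<Rightarrow> real \<Rightarrow> real \<Rightarrow> real \<Rightarrow> real" where
  "rect_volume F x1 x2 y1 y2 = F (x2, y2) + F (x1, y1) - F (x2, y1) - F (x1, y2)"

text \<open>The bounds \<open>0 \<le> F (x, y) \<le> 1\<close> come for free: \<open>F (x, y)\<close> is the volume of
  \<open>[0, x] \<times> [0, y]\<close>, and \<open>x - F (x, y)\<close> is that of \<open>[0, x] \<times> [y, 1]\<close>.\<close>

lemma copula_restrictI:
  assumes bdry: "copula_boundary F"
    and vol: "\<And>x1 x2 y1 y2. \<lbrakk>0 \<le> x1; x1 \<le> x2; x2 \<le> 1; 0 \<le> y1; y1 \<le> y2; y2 \<le> 1\<rbrakk>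
      \<Longrightarrow> 0 \<le> rect_volume F x1 x2 y1 y2"
  shows "copula (restrict F unit_square)"
proof -
  have "0 \<le> F (x, y) \<and> F (x, y) \<le> 1" if "x \<in> {0..1}" "y \<in> {0..1}" for x y
    using that bdry vol[of 0 x 0 y] vol[of 0 x y 1]
    by (auto simp: copula_boundary_def rect_volume_def)
  then show ?thesis
    using bdry vol by (auto simp: copula_def copula_boundary_def rect_volume_def)
qed

lemma rect_volume_product: "rect_volume (\<lambda>(x, y). x * y) x1 x2 y1 y2 = (x2 - x1) * (y2 - y1)"
  by (simp add: rect_volume_def algebra_simps)

lemma copula_product: "copula (restrict (\<lambda>(x, y). x * y) unit_square)"
  by (rule copula_restrictI) (simp_all add: copula_boundary_def rect_volume_product)

lemma fun_span_on_lincomb2: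
  assumes "f \<in> B" "g \<in> B"
  shows "restrict (\<lambda>p. a * f p + b * g p) S \<in> fun_span_on S B"
proof -
  \<comment> \<open>Adding the two indicators makes the coefficients correct also when \<open>f = g\<close>.\<close>
  define r where "r h = (if h = f then a else 0) + (if h = g then b else 0)" for h
  have "(\<Sum>h\<in>{f, g}. r h * h p) = a * f p + b * g p" for p
    by (cases "f = g") (auto simp: r_def algebra_simps)
  then have "restrict (\<lambda>p. a * f p + b * g p) S = restrict (\<lambda>p. \<Sum>h\<in>{f, g}. r h * h p) S"
    by presburger
  then show ?thesis
    unfolding fun_span_on_def using assms
    by (intro CollectI exI[of _ "{f, g}"] exI[of _ r]) auto
qed

lemma in_copula_span_if_rect_volume_ge:
  assumes bdry: "copula_boundary F" and "0 \<le> c"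
    and vol: "\<And>x1 x2 y1 y2. \<lbrakk>0 \<le> x1; x1 \<le> x2; x2 \<le> 1; 0 \<le> y1; y1 \<le> y2; y2 \<le> 1\<rbrakk>
      \<Longrightarrow> - c * ((x2 - x1) * (y2 - y1)) \<le> rect_volume F x1 x2 y1 y2"
  shows "restrict F unit_square \<in> fun_span_on unit_square {C. copula C}"
proof -
  define G where "G = (\<lambda>(x, y). (F (x, y) + c * (x * y)) / (1 + c))"
  have nz: "1 + c \<noteq> 0"
    using \<open>0 \<le> c\<close> by linarith
  have "rect_volume G x1 x2 y1 y2
      = (rect_volume F x1 x2 y1 y2 + c * ((x2 - x1) * (y2 - y1))) / (1 + c)" for x1 x2 y1 y2
    unfolding rect_volume_product[symmetric]
    by (simp add: G_def rect_volume_def add_divide_distrib diff_divide_distrib right_diff_distrib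
        distrib_left)
  then have "0 \<le> rect_volume G x1 x2 y1 y2"
    if "0 \<le> x1" "x1 \<le> x2" "x2 \<le> 1" "0 \<le> y1" "y1 \<le> y2" "y2 \<le> 1" for x1 x2 y1 y2
    using vol[OF that] \<open>0 \<le> c\<close> by simp
  moreover have "(t + c * t) / (1 + c) = t" for t
    using nz by (simp add: divide_eq_eq distrib_left)
  then have "copula_boundary G"
    using bdry by (simp add: copula_boundary_def G_def)
  ultimately have G: "copula (restrict G unit_square)"
    by (intro copula_restrictI)
  have "F p = (1 + c) * G p + (- c) * (case p of (x, y) \<Rightarrow> x * y)" for p
    using nz by (cases p) (simp add: G_def)
  then have "restrict F unit_square
      = restrict (\<lambda>p. (1 + c) * restrict G unit_square p
        + (- c) * restrict (\<lambda>(x, y). x * y) unit_square p) unit_square"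
    by (intro restrict_ext) simp
  also have "\<dots> \<in> fun_span_on unit_square {C. copula C}"
    using G copula_product by (intro fun_span_on_lincomb2 CollectI)
  finally show ?thesis .
qed

section \<open>Estimates for Bernstein polynomials\<close>

lemma Bernstein_at_0: "Bernstein n k 0 = (if k = 0 then 1 else 0)"
  by (simp add: Bernstein_def)

lemma Bernstein_at_1: "k \<le> n \<Longrightarrow> Bernstein n k 1 = (if k = n then 1 else 0)"
  by (auto simp: Bernstein_def)

text \<open>Any Lipschitz constant serves the purpose; this one follows from the crude bound \<open>2 ^ n\<close> on
  the binomial coefficient and from \<open>x ^ k\<close> being \<open>k\<close>-Lipschitz on the unit interval.\<close>

lemma Bernstein_Lipschitz:
  assumes "k \<le> n" "x \<in> {0..1}" "y \<in> {0..1}"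
  shows "\<bar>Bernstein n k x - Bernstein n k y\<bar> \<le> 2 ^ n * real n * \<bar>x - y\<bar>"
proof -
  let ?m = "n - k"
  have "\<bar>x ^ k * (1 - x) ^ ?m - y ^ k * (1 - y) ^ ?m\<bar>
      = \<bar>(x ^ k - y ^ k) * (1 - x) ^ ?m + y ^ k * ((1 - x) ^ ?m - (1 - y) ^ ?m)\<bar>"
    by (simp add: algebra_simps)
  also have "\<dots> \<le> \<bar>x ^ k - y ^ k\<bar> * (1 - x) ^ ?m + y ^ k * \<bar>(1 - x) ^ ?m - (1 - y) ^ ?m\<bar>"
    using assms by (intro order_trans[OF abs_triangle_ineq]) (simp add: abs_mult)
  also have "\<dots> \<le> \<bar>x ^ k - y ^ k\<bar> * 1 + 1 * \<bar>(1 - x) ^ ?m - (1 - y) ^ ?m\<bar>"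
    using assms by (intro add_mono mult_mono) (auto simp: power_le_one)
  also have "\<dots> \<le> real k * \<bar>x - y\<bar> + real ?m * \<bar>x - y\<bar>"
    using assms norm_power_diff[of x y k] norm_power_diff[of "1 - x" "1 - y" ?m]
    by (intro add_mono) (auto simp: abs_minus_commute)
  also have "\<dots> = real n * \<bar>x - y\<bar>"
    using \<open>k \<le> n\<close> by (simp flip: distrib_right of_nat_add)
  finally have pow: "\<bar>x ^ k * (1 - x) ^ ?m - y ^ k * (1 - y) ^ ?m\<bar> \<le> real n * \<bar>x - y\<bar>" .
  have "real (n choose k) \<le> 2 ^ n"
    using binomial_le_pow2[of n k] by (metis of_nat_le_iff of_nat_numeral of_nat_power)
  then have "real (n choose k) * \<bar>x ^ k * (1 - x) ^ ?m - y ^ k * (1 - y) ^ ?m\<bar>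
      \<le> 2 ^ n * (real n * \<bar>x - y\<bar>)"
    using pow by (intro mult_mono) auto
  then show ?thesis
    by (simp add: Bernstein_def mult.assoc abs_mult flip: right_diff_distrib)
qed

lemma Bernstein_variance:
  assumes "0 < n"
  shows "(\<Sum>k\<le>n. (real k / n - x)\<^sup>2 * Bernstein n k x) = x * (1 - x) / n"
proof -
  have "(real k / n - x)\<^sup>2 * Bernstein n k x
      = (real k * (real k - 1) * Bernstein n k x) / n\<^sup>2
        + (1 / n\<^sup>2 - 2 * x / n) * (real k * Bernstein n k x) + x\<^sup>2 * Bernstein n k x" for k
    using assms by (simp add: field_simps power2_eq_square)
  then have "(\<Sum>k\<le>n. (real k / n - x)\<^sup>2 * Bernstein n k x)
      = (real n * (real n - 1) * x\<^sup>2) / n\<^sup>2 + (1 / n\<^sup>2 - 2 * x / n) * (real n * x) + x\<^sup>2"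
    by (simp add: sum.distrib flip: sum_divide_distrib sum_distrib_left)
  also have "\<dots> = x * (1 - x) / n"
    using assms by (simp add: field_simps power2_eq_square)
  finally show ?thesis .
qed

lemma Bernstein_mean_deviation:
  assumes "0 < n" "x \<in> {0..1}"
  shows "(\<Sum>k\<le>n. \<bar>real k / n - x\<bar> * Bernstein n k x) \<le> 1 / sqrt n"
proof -
  define s where "s = sqrt (real n)"
  have s: "0 < s" "s * s = n"
    using assms by (simp_all add: s_def)
  \<comment> \<open>The weight \<open>s\<close> makes the two terms equal after averaging with a variance of \<open>1 / n\<close>.\<close>
  have amgm: "\<bar>t\<bar> \<le> 1 / (2 * s) + s / 2 * t\<^sup>2" for t
  proof -
    have "0 \<le> (s * \<bar>t\<bar> - 1)\<^sup>2"
      by simp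
    then have "2 * s * \<bar>t\<bar> \<le> 1 + s\<^sup>2 * t\<^sup>2"
      by (simp add: power2_diff power_mult_distrib)
    then show ?thesis
      using s(1) by (simp add: field_simps power2_eq_square)
  qed
  have "(\<Sum>k\<le>n. \<bar>real k / n - x\<bar> * Bernstein n k x)
      \<le> (\<Sum>k\<le>n. (1 / (2 * s) + s / 2 * (real k / n - x)\<^sup>2) * Bernstein n k x)"
    using assms amgm by (intro sum_mono mult_right_mono Bernstein_nonneg) auto
  also have "\<dots> = 1 / (2 * s) + s / 2 * (x * (1 - x) / n)"
    unfolding distrib_right sum.distrib mult.assoc sum_distrib_left[symmetric]
    by (simp add: Bernstein_variance[OF \<open>0 < n\<close>])
  also have "\<dots> \<le> 1 / (2 * s) + s / 2 * (1 / n)"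
    using assms s mult_mono[of x 1 "1 - x" 1]
    by (intro add_left_mono mult_left_mono divide_right_mono) auto
  also have "\<dots> = 1 / s"
    using s \<open>0 < n\<close> by (simp add: field_simps)
  finally show ?thesis
    by (simp add: s_def)
qed

section \<open>Bernstein polynomials in two variables\<close>

definition bernstein_surface :: "nat \<Rightarrow> (real \<times> real \<Rightarrow> real) \<Rightarrow> real \<times> real \<Rightarrow> real" where
  "bernstein_surface n Q = (\<lambda>(x, y).
     \<Sum>i\<le>n. \<Sum>j\<le>n. Q (real i / n, real j / n) * (Bernstein n i x * Bernstein n j y))"

text \<open>On an edge of the square only the grid points of that edge contribute, so there the
  polynomial is the univariate Bernstein polynomial of the identity or of zero.\<close>

lemma copula_boundary_bernstein_surface:
  assumes Q: "copula_boundary Q" and "0 < n"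
  shows "copula_boundary (bernstein_surface n Q)"
proof -
  have grid: "real i / n \<in> {0..1}" if "i \<le> n" for i
    using that \<open>0 < n\<close> by auto
  have Q_edges: "Q (real i / n, 0) = 0" "Q (0, real i / n) = 0"
      "Q (real i / n, 1) = real i / n" "Q (1, real i / n) = real i / n" if "i \<le> n" for i
    using Q grid[OF that] by (simp_all add: copula_boundary_def)
  have mean: "(\<Sum>i\<le>n. real i / n * Bernstein n i x) = x" for x
    using \<open>0 < n\<close> sum_k_Bernstein[of n x] by (simp flip: sum_divide_distrib)
  have delta: "(\<Sum>i\<le>n. f i * (if i = m then 1 else 0)) = (f m :: real)" if "m \<le> n" for f m
    using that by (simp add: if_distrib cong: if_cong)
  have "bernstein_surface n Q (x, 0) = 0" for x
  proof -
    have "bernstein_surface n Q (x, 0) =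
        (\<Sum>i\<le>n. \<Sum>j\<le>n. (Q (real i / n, real j / n) * Bernstein n i x) * (if j = 0 then 1 else 0))"
      by (simp add: bernstein_surface_def Bernstein_at_0 mult.assoc)
    then show ?thesis
      by (simp only: delta[OF le0]) (simp add: Q_edges)
  qed
  moreover have "bernstein_surface n Q (0, y) = 0" for y
  proof -
    have "bernstein_surface n Q (0, y) =
        (\<Sum>j\<le>n. \<Sum>i\<le>n. (Q (real i / n, real j / n) * Bernstein n j y) * (if i = 0 then 1 else 0))"
      by (subst sum.swap) (simp add: bernstein_surface_def Bernstein_at_0 mult_ac)
    then show ?thesis
      by (simp only: delta[OF le0]) (simp add: Q_edges)
  qed
  moreover have "bernstein_surface n Q (x, 1) = x" for x
  proof -
    have "bernstein_surface n Q (x, 1) =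
        (\<Sum>i\<le>n. \<Sum>j\<le>n. (Q (real i / n, real j / n) * Bernstein n i x) * (if j = n then 1 else 0))"
      by (simp add: bernstein_surface_def Bernstein_at_1 mult.assoc)
    then show ?thesis
      using \<open>0 < n\<close> mean[of x] by (simp only: delta[OF order_refl]) (simp add: Q_edges)
  qed
  moreover have "bernstein_surface n Q (1, y) = y" for y
  proof -
    have "bernstein_surface n Q (1, y) =
        (\<Sum>j\<le>n. \<Sum>i\<le>n. (Q (real i / n, real j / n) * Bernstein n j y) * (if i = n then 1 else 0))"
      by (subst sum.swap) (simp add: bernstein_surface_def Bernstein_at_1 mult_ac)
    then show ?thesis
      using \<open>0 < n\<close> mean[of y] by (simp only: delta[OF order_refl]) (simp add: Q_edges)
  qed
  ultimately show ?thesis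
    by (simp add: copula_boundary_def)
qed

lemma rect_volume_bernstein_surface:
  "rect_volume (bernstein_surface n Q) x1 x2 y1 y2 =
     (\<Sum>i\<le>n. \<Sum>j\<le>n. Q (real i / n, real j / n) *
       ((Bernstein n i x2 - Bernstein n i x1) * (Bernstein n j y2 - Bernstein n j y1)))"
  by (simp add: rect_volume_def bernstein_surface_def algebra_simps sum.distrib sum_subtractf)

lemma rect_volume_bernstein_surface_ge:
  assumes Q: "\<And>p. p \<in> unit_square \<Longrightarrow> \<bar>Q p\<bar> \<le> M"
  obtains c where "0 \<le> c"
    "\<And>x1 x2 y1 y2. \<lbrakk>0 \<le> x1; x1 \<le> x2; x2 \<le> 1; 0 \<le> y1; y1 \<le> y2; y2 \<le> 1\<rbrakk>
      \<Longrightarrow> - c * ((x2 - x1) * (y2 - y1)) \<le> rect_volume (bernstein_surface n Q) x1 x2 y1 y2"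
proof
  define L where "L = 2 ^ n * real n"
  define c where "c = real (Suc n) * (real (Suc n) * (M * (L * L)))"
  have "0 \<le> L"
    by (simp add: L_def)
  have "0 \<le> M"
    using Q[of "(0, 0)"] by simp
  then show "0 \<le> c"
    using \<open>0 \<le> L\<close> by (simp add: c_def)
  fix x1 x2 y1 y2 :: real
  assume xy: "0 \<le> x1" "x1 \<le> x2" "x2 \<le> 1" "0 \<le> y1" "y1 \<le> y2" "y2 \<le> 1"
  let ?V = "\<lambda>i j. Q (real i / n, real j / n) *
    ((Bernstein n i x2 - Bernstein n i x1) * (Bernstein n j y2 - Bernstein n j y1))"
  have "\<bar>?V i j\<bar> \<le> M * ((L * (x2 - x1)) * (L * (y2 - y1)))" if "i \<le> n" "j \<le> n" for i j
  proof -
    have "\<bar>Q (real i / n, real j / n)\<bar> \<le> M"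
      using that by (intro Q) (auto simp: divide_le_eq_1)
    moreover have "\<bar>Bernstein n i x2 - Bernstein n i x1\<bar> \<le> L * (x2 - x1)"
      using Bernstein_Lipschitz[of i n x2 x1] that xy by (simp add: L_def)
    moreover have "\<bar>Bernstein n j y2 - Bernstein n j y1\<bar> \<le> L * (y2 - y1)"
      using Bernstein_Lipschitz[of j n y2 y1] that xy by (simp add: L_def)
    ultimately show ?thesis
      unfolding abs_mult using \<open>0 \<le> M\<close> \<open>0 \<le> L\<close> xy by (intro mult_mono) auto
  qed
  then have "(\<Sum>i\<le>n. \<Sum>j\<le>n. \<bar>?V i j\<bar>)
      \<le> (\<Sum>i\<le>n. \<Sum>j\<le>n. M * ((L * (x2 - x1)) * (L * (y2 - y1))))"
    by (intro sum_mono) auto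
  also have "\<dots> = c * ((x2 - x1) * (y2 - y1))"
    unfolding sum_constant card_atMost c_def by (simp only: mult_ac)
  finally have "(\<Sum>i\<le>n. \<Sum>j\<le>n. \<bar>?V i j\<bar>) \<le> c * ((x2 - x1) * (y2 - y1))" .
  moreover have "\<bar>\<Sum>i\<le>n. \<Sum>j\<le>n. ?V i j\<bar> \<le> (\<Sum>i\<le>n. \<Sum>j\<le>n. \<bar>?V i j\<bar>)"
    by (rule order_trans[OF sum_abs sum_mono[OF sum_abs]])
  ultimately show "- c * ((x2 - x1) * (y2 - y1)) \<le> rect_volume (bernstein_surface n Q) x1 x2 y1 y2"
    unfolding rect_volume_bernstein_surface by linarith
qed

text \<open>The value at \<open>(x, y)\<close> is an average of grid values with product binomial weights, so the
  Lipschitz condition bounds the error by the mean absolute deviations in the two coordinates.\<close>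

lemma bernstein_surface_error:
  assumes lip: "\<And>x1 y1 x2 y2. \<lbrakk>(x1, y1) \<in> unit_square; (x2, y2) \<in> unit_square\<rbrakk>
      \<Longrightarrow> \<bar>Q (x2, y2) - Q (x1, y1)\<bar> \<le> \<bar>x2 - x1\<bar> + \<bar>y2 - y1\<bar>"
    and "0 < n" and xy: "x \<in> {0..1}" "y \<in> {0..1}"
  shows "\<bar>bernstein_surface n Q (x, y) - Q (x, y)\<bar> \<le> 2 / sqrt n"
proof -
  let ?b = "\<lambda>i. Bernstein n i x" and ?b' = "\<lambda>j. Bernstein n j y"
  let ?Q = "\<lambda>i j. Q (real i / n, real j / n)"
  have nonneg: "0 \<le> ?b i" "0 \<le> ?b' i" for i
    using xy by (auto intro: Bernstein_nonneg)
  have total: "(\<Sum>i\<le>n. \<Sum>j\<le>n. q * (?b i * ?b' j)) = q" for q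
    by (simp flip: sum_distrib_left)
  have "\<bar>bernstein_surface n Q (x, y) - Q (x, y)\<bar>
      = \<bar>\<Sum>i\<le>n. \<Sum>j\<le>n. (?Q i j - Q (x, y)) * (?b i * ?b' j)\<bar>"
    using total[of "Q (x, y)"]
    by (simp add: bernstein_surface_def left_diff_distrib sum_subtractf)
  also have "\<dots> \<le> (\<Sum>i\<le>n. \<Sum>j\<le>n. \<bar>(?Q i j - Q (x, y)) * (?b i * ?b' j)\<bar>)"
    by (rule order_trans[OF sum_abs sum_mono[OF sum_abs]])
  also have "\<dots> \<le> (\<Sum>i\<le>n. \<Sum>j\<le>n. (\<bar>real i / n - x\<bar> + \<bar>real j / n - y\<bar>) * (?b i * ?b' j))"
  proof (rule sum_mono, rule sum_mono)
    fix i j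
    assume "i \<in> {..n}" "j \<in> {..n}"
    then have "(real i / n, real j / n) \<in> unit_square"
      using \<open>0 < n\<close> by simp
    then have "\<bar>?Q i j - Q (x, y)\<bar> \<le> \<bar>real i / n - x\<bar> + \<bar>real j / n - y\<bar>"
      using xy by (intro lip) (rule SigmaI)
    then show "\<bar>(?Q i j - Q (x, y)) * (?b i * ?b' j)\<bar>
        \<le> (\<bar>real i / n - x\<bar> + \<bar>real j / n - y\<bar>) * (?b i * ?b' j)"
      unfolding abs_mult using nonneg by (intro mult_mono) auto
  qed
  also have "\<dots> = (\<Sum>i\<le>n. \<Sum>j\<le>n. (\<bar>real i / n - x\<bar> * ?b i) * ?b' j)
      + (\<Sum>i\<le>n. \<Sum>j\<le>n. ?b i * (\<bar>real j / n - y\<bar> * ?b' j))"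
    unfolding distrib_right sum.distrib by (simp only: mult_ac)
  also have "\<dots> = (\<Sum>i\<le>n. \<bar>real i / n - x\<bar> * ?b i) + (\<Sum>j\<le>n. \<bar>real j / n - y\<bar> * ?b' j)"
    by (simp flip: sum_distrib_left sum_distrib_right)
  also have "\<dots> \<le> 2 / sqrt n"
    using Bernstein_mean_deviation[OF \<open>0 < n\<close> xy(1)] Bernstein_mean_deviation[OF \<open>0 < n\<close> xy(2)]
    by simp
  finally show ?thesis .
qed

section \<open>Density in the supremum norm\<close>

lemma closure_of_funspaceI:
  fixes f :: "'a \<Rightarrow> real"
  assumes "S \<noteq> {}" and f: "f \<in> extensional S" "bounded (f ` S)"
    and approx: "\<And>e. 0 < e \<Longrightarrow> \<exists>g\<in>A. g \<in> extensional S \<and> (\<forall>p\<in>S. \<bar>f p - g p\<bar> \<le> e)"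
  shows "f \<in> mtopology_of (funspace S euclidean_metric) closure_of A"
proof -
  let ?m = "funspace S (euclidean_metric :: real metric)"
  interpret F: Metric_space "mspace ?m" "mdist ?m"
    by (rule Metric_space_mspace_mdist)
  have mem: "h \<in> mspace ?m" if "h \<in> extensional S" "bounded (h ` S)" for h
    using that by (simp add: Met_TC.fspace_def)
  have "\<exists>g\<in>A. g \<in> F.mball f r" if "0 < r" for r
  proof -
    obtain g where g: "g \<in> A" "g \<in> extensional S" "\<And>p. p \<in> S \<Longrightarrow> \<bar>f p - g p\<bar> \<le> r / 2"
      using approx[of "r / 2"] \<open>0 < r\<close> by auto
    obtain M where M: "\<And>p. p \<in> S \<Longrightarrow> \<bar>f p\<bar> \<le> M"
      using f(2) by (auto simp: bounded_iff)
    have "\<bar>g p\<bar> \<le> M + r / 2" if "p \<in> S" for p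
      using M[OF that] g(3)[OF that] by linarith
    then have bg: "bounded (g ` S)"
      by (auto simp: bounded_iff)
    have "mdist ?m f g = (SUP p\<in>S. \<bar>f p - g p\<bar>)"
      using f g(2) bg \<open>S \<noteq> {}\<close> by (intro mdist_funspace_sup_norm)
    also have "\<dots> \<le> r / 2"
      using \<open>S \<noteq> {}\<close> g(3) by (intro cSUP_least)
    finally have "mdist ?m f g < r"
      using \<open>0 < r\<close> by simp
    then show ?thesis
      using g(1) mem[OF f] mem[OF g(2) bg] by (intro bexI[of _ g]) (simp only: F.in_mball, simp)
  qed
  then show ?thesis
    unfolding mtopology_of_def F.metric_closure_of using mem[OF f] by blast
qed

theorem corollary9:
  shows "{Q. quasi_copula Q} \<subseteq>
    mtopology_of (funspace unit_square euclidean_metric) closure_of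
      fun_span_on unit_square {C. copula C}"
proof
  fix Q
  assume "Q \<in> {Q. quasi_copula Q}"
  then have Q: "quasi_copula Q"
    by simp
  have range: "Q \<in> unit_square \<rightarrow>\<^sub>E {0..1}"
    using Q by (simp add: quasi_copula_def)
  have bound: "\<bar>Q p\<bar> \<le> 1" if "p \<in> unit_square" for p
    using PiE_mem[OF range that] by simp
  have bdry: "copula_boundary Q"
    using Q by (simp add: quasi_copula_def copula_boundary_def)
  have lip: "\<bar>Q (x2, y2) - Q (x1, y1)\<bar> \<le> \<bar>x2 - x1\<bar> + \<bar>y2 - y1\<bar>"
    if "(x1, y1) \<in> unit_square" "(x2, y2) \<in> unit_square" for x1 y1 x2 y2
    using Q that unfolding quasi_copula_def by (elim conjE) blast
  show "Q \<in> mtopology_of (funspace unit_square euclidean_metric) closure_of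
      fun_span_on unit_square {C. copula C}"
  proof (rule closure_of_funspaceI)
    show "unit_square \<noteq> {}" "Q \<in> extensional unit_square"
      using range by (auto simp: PiE_def)
    show "bounded (Q ` unit_square)"
      using bound by (auto simp: bounded_iff)
  next
    fix e :: real
    assume "0 < e"
    obtain n where n: "(2 / e)\<^sup>2 < real n"
      using reals_Archimedean2 by blast
    have "0 < n"
      using n zero_le_power2[of "2 / e"] by (metis of_nat_0_less_iff order_le_less_trans)
    have "2 / e < sqrt n"
      using n by (rule real_less_rsqrt)
    then have small: "2 / sqrt n \<le> e"
      using \<open>0 < e\<close> \<open>0 < n\<close> by (simp add: field_simps)
    let ?B = "bernstein_surface n Q"
    obtain c where "0 \<le> c" "\<And>x1 x2 y1 y2. \<lbrakk>0 \<le> x1; x1 \<le> x2; x2 \<le> 1; 0 \<le> y1; y1 \<le> y2; y2 \<le> 1\<rbrakk>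
        \<Longrightarrow> - c * ((x2 - x1) * (y2 - y1)) \<le> rect_volume ?B x1 x2 y1 y2"
      using rect_volume_bernstein_surface_ge[of Q 1] bound by blast
    then have "restrict ?B unit_square \<in> fun_span_on unit_square {C. copula C}"
      using copula_boundary_bernstein_surface[OF bdry \<open>0 < n\<close>]
      by (intro in_copula_span_if_rect_volume_ge)
    moreover have "\<bar>Q p - restrict ?B unit_square p\<bar> \<le> e" if p_in: "p \<in> unit_square" for p
    proof -
      obtain x y where p: "p = (x, y)" "x \<in> {0..1}" "y \<in> {0..1}"
        using p_in by blast
      have "\<bar>?B (x, y) - Q (x, y)\<bar> \<le> 2 / sqrt n"
        by (rule bernstein_surface_error[OF lip \<open>0 < n\<close> p(2,3)])
      then show ?thesis
        using small p_in by (simp add: p(1) abs_minus_commute)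
    qed
    moreover have "restrict ?B unit_square \<in> extensional unit_square"
      by simp
    ultimately show "\<exists>g\<in>fun_span_on unit_square {C. copula C}.
        g \<in> extensional unit_square \<and> (\<forall>p\<in>unit_square. \<bar>Q p - g p\<bar> \<le> e)"
      by blast
  qed
qed

end
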